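(* Let $W(x,\vec t)=e^{-v(x,\vec t)}\widetilde W(x)$ be an $N\times N$ matrix weight with $v(x,\vec t)=v(x,t_1,\dots,t_k)=\sum_{j=1}^kt_jx^j$, where $k$ is even and $t_k>0$. Let $B(n),C(n)$ (depending on $\vec t$) be the three-term recurrence coefficients of the monic matrix valued orthogonal polynomials with respect to $W(\cdot,\vec t)$, and let $L$ be the semi-infinite block tridiagonal matrix with $N\times N$ blocks $L_{n,n+1}=I$, $L_{n,n}=B(n)$, $L_{n,n-1}=C(n)$ and $L_{n,m}=0$ if $|n-m|\ge2$ ($n,m\ge0$). Then for $j=1,\dots,k-1$, with $\dot{\ }$ denoting the derivative with respect to $t_j$, $$\dot L=\left[L,(L^j)_+\right]=-\left[L,(L^j)_-\right].$$
   Context: For $\vec t$ in an open set of parameters in $\mathbb{R}^k$, $W(\cdot,\vec t)$ is a positive definite $M_N(\mathbb{C})$-valued weight function on a (possibly infinite) interval of $\mathbb{R}$ with finite moments of all orders. With $\langle F,G\rangle=\int F(y)W(y,\vec t)G(y)^*\,dy$, the monic MVOPs $P(x,n)=x^nI+\cdots$ satisfy $\langle P(\cdot,n),P(\cdot,m)\rangle=\mathcal{H}(n)\delta_{n,m}$ and $xP(x,n)=P(x,n+1)+B(n)P(x,n)+C(n)P(x,n-1)$. For a semi-infinite block matrix $S=(S_{nm})$ with $N\times N$ blocks, $S_+$ is obtained by replacing all blocks below the main diagonal by zero (so $S_+$ keeps the main diagonal), and $S_-$ is obtained by replacing all blocks above the first subdiagonal by zero (so $S_-$ is strictly block lower triangular,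 and $S=S_++S_-$). $[X,Y]=XY-YX$. *)

theory Defs
  imports "HOL-Analysis.Analysis"
begin

type_synonym 'n cmat = "complex ^ 'n ^ 'n"

definition ctranspose :: "'n::finite cmat \<Rightarrow> 'n cmat" where
  "ctranspose A = (\<chi> i j. cnj (A $ j $ i))"

definition pos_def :: "'n::finite cmat \<Rightarrow> bool" where
  "pos_def A \<longleftrightarrow>
     ctranspose A = A \<and> (\<forall>u. u \<noteq> 0 \<longrightarrow> 0 < Re (\<Sum>i\<in>UNIV. cnj (u $ i) * (A *v u) $ i))"

text \<open>The interval may be open, closed or half-open, bounded or not.  Positive definiteness is
  required almost everywhere, so a weight may degenerate at, say, an endpoint.\<close>
definition matrix_weight :: "real set \<Rightarrow> (real \<Rightarrow> 'n::finite cmat) \<Rightarrow> bool" where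
  "matrix_weight I W \<longleftrightarrow>
     is_interval I \<and> interior I \<noteq> {} \<and>
     (AE x in lborel. x \<in> I \<longrightarrow> pos_def (W x)) \<and>
     (\<forall>n. set_integrable lborel I (\<lambda>x. x ^ n *\<^sub>R W x))"

definition mv_inner ::
  "real set \<Rightarrow> (real \<Rightarrow> 'n::finite cmat) \<Rightarrow> (real \<Rightarrow> 'n cmat) \<Rightarrow> (real \<Rightarrow> 'n cmat) \<Rightarrow> 'n cmat" where
  "mv_inner I W F G = (LINT y:I|lborel. F y ** W y ** ctranspose (G y))"

definition monic_mv_poly :: "nat \<Rightarrow> (real \<Rightarrow> 'n::finite cmat) \<Rightarrow> bool" where
  "monic_mv_poly n p \<longleftrightarrow> (\<exists>a. \<forall>x. p x = x ^ n *\<^sub>R mat 1 + (\<Sum>i<n. x ^ i *\<^sub>R a i))"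

definition monic_mvops ::
  "real set \<Rightarrow> (real \<Rightarrow> 'n::finite cmat) \<Rightarrow> (nat \<Rightarrow> real \<Rightarrow> 'n cmat) \<Rightarrow> (nat \<Rightarrow> 'n cmat) \<Rightarrow> bool" where
  "monic_mvops I W P H \<longleftrightarrow>
     (\<forall>n. monic_mv_poly n (P n)) \<and>
     (\<forall>n m. mv_inner I W (P n) (P m) = (if n = m then H n else 0))"

text \<open>The convention \<open>P (-1) = 0\<close> is built in, so \<open>C 0\<close> is irrelevant.\<close>
definition three_term_recurrence ::
  "(nat \<Rightarrow> real \<Rightarrow> 'n::finite cmat) \<Rightarrow> (nat \<Rightarrow> 'n cmat) \<Rightarrow> (nat \<Rightarrow> 'n cmat) \<Rightarrow> bool" where
  "three_term_recurrence P B C \<longleftrightarrow>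
     (\<forall>n x. x *\<^sub>R P n x =
        P (n + 1) x + B n ** P n x + (if n = 0 then 0 else C n ** P (n - 1) x))"

definition potential :: "nat \<Rightarrow> (nat \<Rightarrow> real) \<Rightarrow> real \<Rightarrow> real" where
  "potential k t x = (\<Sum>j=1..k. t j * x ^ j)"

definition toda_weight ::
  "nat \<Rightarrow> (real \<Rightarrow> 'n::finite cmat) \<Rightarrow> (nat \<Rightarrow> real) \<Rightarrow> real \<Rightarrow> 'n cmat" where
  "toda_weight k Wt t x = exp (- potential k t x) *\<^sub>R Wt x"

type_synonym 'n block_matrix = "nat \<Rightarrow> nat \<Rightarrow> 'n cmat"

text \<open>The series is a finite sum whenever \<open>X\<close> has finitely many nonzero blocks in each row.  This is
  the case for every product of a block tridiagonal matrix, its powers, and their upper and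
  lower parts.\<close>
definition block_mult :: "'n::finite block_matrix \<Rightarrow> 'n block_matrix \<Rightarrow> 'n block_matrix" where
  "block_mult X Y = (\<lambda>n m. \<Sum>l. X n l ** Y l m)"

primrec block_power :: "'n::finite block_matrix \<Rightarrow> nat \<Rightarrow> 'n block_matrix" where
  "block_power X 0 = (\<lambda>n m. if n = m then mat 1 else 0)"
| "block_power X (Suc j) = block_mult X (block_power X j)"

definition block_commutator :: "'n::finite block_matrix \<Rightarrow> 'n block_matrix \<Rightarrow> 'n block_matrix" where
  "block_commutator X Y = (\<lambda>n m. block_mult X Y n m - block_mult Y X n m)"

definition upper_part :: "'n::finite block_matrix \<Rightarrow> 'n block_matrix" where
  "upper_part S = (\<lambda>n m. if m < n then 0 else S n m)"

definition lower_part :: "'n::finite block_matrix \<Rightarrow> 'n block_matrix" where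
  "lower_part S = (\<lambda>n m. if m < n then S n m else 0)"

definition jacobi_block :: "(nat \<Rightarrow> 'n::finite cmat) \<Rightarrow> (nat \<Rightarrow> 'n cmat) \<Rightarrow> 'n block_matrix" where
  "jacobi_block B C = (\<lambda>n m.
     if m = n + 1 then mat 1 else if m = n then B n else if n = m + 1 then C n else 0)"

end

theory Submission
  imports Defs
begin

text \<open>Fix \<open>t\<close>, let \<open>s\<close> be the \<open>j\<close>-th parameter with value \<open>c = t j\<close> at \<open>t\<close>, and write
  \<open>P\<close> for the column vector of the orthogonal polynomials at \<open>t\<close>.  For \<open>s\<close> near \<open>c\<close> the
  orthogonal polynomials of the deformed weight are again monic, so they are \<open>(1 + A(s)) P\<close> with a
  strictly lower triangular block matrix \<open>A(s)\<close> of constants, and \<open>A(c) = 0\<close>.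

  The first step finds the derivative of \<open>A\<close> at \<open>c\<close>.  Changing \<open>s\<close> multiplies the weight by
  \<open>exp (- (s - c) x ^ j)\<close>, hence the Gram matrix of the fixed polynomials \<open>P\<close> has the derivative
  \<open>- \<langle>x ^ j P(n), P(m)\<rangle> = - (L ^ j)(n, m) H(m)\<close>; here \<open>x ^ j P = L ^ j P\<close> by the three term recurrence
  (\<open>mv_inner_exp_derivative\<close>, \<open>power_recurrence\<close>).  Orthogonality of the deformed polynomials to \<open>P(m)\<close>
  for \<open>m < n\<close> is a linear system for row \<open>n\<close> of \<open>A(s)\<close>, whose coefficients are the entries of this
  Gram matrix (\<open>orthogonality_perturbed\<close>).  The norms \<open>H(m)\<close> are invertible because the weight is
  positive definite (\<open>invertible_mv_norm\<close>), so the system is a small perturbation of an invertible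
  diagonal one.  To first order it can be solved explicitly, and the derivative of \<open>A\<close> at \<open>c\<close> is the
  strictly lower part of \<open>L ^ j\<close> (\<open>perturbed_system_derivative\<close>).

  The second step passes to \<open>L\<close>.  Multiplication by \<open>x\<close> in the two bases gives
  \<open>L(s) (1 + A(s)) = (1 + A(s)) L(c)\<close> (\<open>recurrence_conjugation\<close>).  Differentiating at \<open>c\<close>, where \<open>A\<close>
  vanishes, yields the negative of the commutator of \<open>L\<close> with the strictly lower part of \<open>L ^ j\<close>
  (\<open>conjugation_derivative\<close>).  As \<open>L\<close> commutes with \<open>L ^ j\<close>, this equals the commutator with the
  upper part (\<open>block_commutator_upper_lower\<close>).\<close>

section \<open>Algebra of complex matrices\<close>

lemma bounded_bilinear_cmat_mult:
  "bounded_bilinear ((**) :: 'n::finite cmat \<Rightarrow> 'n cmat \<Rightarrow> 'n cmat)"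
proof -
  have scaleR: "(r *\<^sub>R X) ** Y = r *\<^sub>R (X ** Y)" "X ** (r *\<^sub>R Y) = r *\<^sub>R (X ** Y)"
    for r and X Y :: "'n cmat"
    by (simp_all add: matrix_matrix_mult_def vec_eq_iff scaleR_sum_right)
  show ?thesis
    unfolding bilinear_conv_bounded_bilinear[symmetric] bilinear_def
    by (auto intro!: linearI simp: scaleR matrix_add_ldistrib)
      (simp add: matrix_matrix_mult_def vec_eq_iff distrib_right sum.distrib)
qed

interpretation cmat_mult: bounded_bilinear "(**) :: 'n::finite cmat \<Rightarrow> 'n cmat \<Rightarrow> 'n cmat"
  by (rule bounded_bilinear_cmat_mult)

lemma bounded_linear_ctranspose: "bounded_linear (ctranspose :: 'n::finite cmat \<Rightarrow> 'n cmat)"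
  unfolding linear_conv_bounded_linear[symmetric]
  by (auto intro!: linearI simp: ctranspose_def vec_eq_iff)

lemmas ctranspose_linear_simps =
  linear_add[OF bounded_linear.linear[OF bounded_linear_ctranspose]]
  linear_sum[OF bounded_linear.linear[OF bounded_linear_ctranspose]]
  linear_scale[OF bounded_linear.linear[OF bounded_linear_ctranspose]]

lemma ctranspose_mult: "ctranspose (X ** Y) = ctranspose Y ** ctranspose X"
  by (simp add: ctranspose_def vec_eq_iff matrix_matrix_mult_def mult.commute)

lemma ctranspose_mat_1 [simp]: "ctranspose (mat 1) = mat 1"
  by (simp add: ctranspose_def vec_eq_iff mat_def)

text \<open>This adjoint identity turns the quadratic form of \<open>p W p\<^sup>*\<close> at a vector \<open>u\<close> into the quadratic
  form of \<open>W\<close> at \<open>p\<^sup>* u\<close>, where positive definiteness of \<open>W\<close> applies.\<close>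
lemma cnj_sum_ctranspose:
  "(\<Sum>i\<in>UNIV. cnj (u $ i) * (X *v z) $ i) = (\<Sum>i\<in>UNIV. cnj ((ctranspose X *v u) $ i) * z $ i)"
proof -
  have "(\<Sum>i\<in>UNIV. cnj (u $ i) * (X *v z) $ i)
      = (\<Sum>i\<in>UNIV. \<Sum>l\<in>UNIV. cnj (u $ i) * X $ i $ l * z $ l)"
    by (simp add: matrix_vector_mult_def sum_distrib_left mult.assoc)
  also have "\<dots> = (\<Sum>l\<in>UNIV. \<Sum>i\<in>UNIV. cnj (u $ i) * X $ i $ l * z $ l)"
    by (rule sum.swap)
  also have "\<dots> = (\<Sum>l\<in>UNIV. cnj ((ctranspose X *v u) $ l) * z $ l)"
    by (simp add: matrix_vector_mult_def ctranspose_def sum_distrib_right sum_distrib_left mult_ac)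
  finally show ?thesis .
qed

section \<open>Matrix polynomials and monic bases\<close>

text \<open>A strict degree bound makes the zero polynomial the only one below \<open>0\<close>, so that
  \<open>n\<close> monic polynomials of degrees \<open>0, \<dots>, n - 1\<close> generate exactly this module.\<close>
definition mat_poly_below :: "nat \<Rightarrow> (real \<Rightarrow> 'n::finite cmat) \<Rightarrow> bool" where
  "mat_poly_below n F \<longleftrightarrow> (\<exists>a. \<forall>x. F x = (\<Sum>i<n. x ^ i *\<^sub>R a i))"

lemma mat_poly_belowI: "(\<And>x. F x = (\<Sum>i<n. x ^ i *\<^sub>R a i)) \<Longrightarrow> mat_poly_below n F"
  unfolding mat_poly_below_def by blast

lemma mat_poly_below_mono:
  assumes "mat_poly_below n F" "n \<le> m"
  shows "mat_poly_below m F"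
proof -
  obtain a where a: "\<And>x. F x = (\<Sum>i<n. x ^ i *\<^sub>R a i)"
    using assms unfolding mat_poly_below_def by blast
  have "F x = (\<Sum>i<m. x ^ i *\<^sub>R (if i < n then a i else 0))" for x
    unfolding a using assms(2) by (intro sum.mono_neutral_cong_left) auto
  then show ?thesis by (rule mat_poly_belowI)
qed

lemma mat_poly_below_diff:
  assumes "mat_poly_below n F" "mat_poly_below n G"
  shows "mat_poly_below n (\<lambda>x. F x - G x)"
proof -
  obtain a b where "\<And>x. F x = (\<Sum>i<n. x ^ i *\<^sub>R a i)" "\<And>x. G x = (\<Sum>i<n. x ^ i *\<^sub>R b i)"
    using assms unfolding mat_poly_below_def by blast
  then have "F x - G x = (\<Sum>i<n. x ^ i *\<^sub>R (a i - b i))" for x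
    by (simp add: scaleR_diff_right sum_subtractf)
  then show ?thesis by (rule mat_poly_belowI)
qed

lemma mat_poly_below_lmult:
  assumes "mat_poly_below n F"
  shows "mat_poly_below n (\<lambda>x. X ** F x)"
proof -
  obtain a where "\<And>x. F x = (\<Sum>i<n. x ^ i *\<^sub>R a i)"
    using assms unfolding mat_poly_below_def by blast
  then have "X ** F x = (\<Sum>i<n. x ^ i *\<^sub>R (X ** a i))" for x
    by (simp add: cmat_mult.sum_right cmat_mult.scaleR_right)
  then show ?thesis by (rule mat_poly_belowI)
qed

lemma mat_poly_below_power_times:
  assumes "mat_poly_below n F"
  shows "mat_poly_below (k + n) (\<lambda>x. x ^ k *\<^sub>R F x)"
proof -
  obtain a where a: "\<And>x. F x = (\<Sum>i<n. x ^ i *\<^sub>R a i)"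
    using assms unfolding mat_poly_below_def by blast
  have "x ^ k *\<^sub>R F x = (\<Sum>i<k + n. x ^ i *\<^sub>R (if i < k then 0 else a (i - k)))" for x
  proof -
    have "(\<Sum>i<k + n. x ^ i *\<^sub>R (if i < k then 0 else a (i - k)))
        = (\<Sum>i\<in>{k..<k + n}. x ^ i *\<^sub>R a (i - k))"
      by (rule sum.mono_neutral_cong_right) auto
    also have "\<dots> = (\<Sum>i<n. x ^ (k + i) *\<^sub>R a i)"
      by (rule sum.reindex_bij_witness[of _ "\<lambda>i. k + i" "\<lambda>i. i - k"]) auto
    finally show ?thesis by (simp add: a scaleR_sum_right power_add)
  qed
  then show ?thesis by (rule mat_poly_belowI)
qed

lemma monic_mv_poly_iff:
  "monic_mv_poly n p \<longleftrightarrow> mat_poly_below n (\<lambda>x. p x - x ^ n *\<^sub>R mat 1)"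
  unfolding monic_mv_poly_def mat_poly_below_def by (simp add: algebra_simps)

lemma monic_imp_mat_poly_below:
  assumes "monic_mv_poly n p"
  shows "mat_poly_below (Suc n) p"
proof -
  obtain a where "\<And>x. p x = x ^ n *\<^sub>R mat 1 + (\<Sum>i<n. x ^ i *\<^sub>R a i)"
    using assms unfolding monic_mv_poly_def by blast
  then have "p x = (\<Sum>i<Suc n. x ^ i *\<^sub>R (a(n := mat 1)) i)" for x by simp
  then show ?thesis by (rule mat_poly_belowI)
qed

lemma monic_diff:
  assumes "monic_mv_poly n p" "monic_mv_poly n q"
  shows "mat_poly_below n (\<lambda>x. p x - q x)"
  using mat_poly_below_diff[OF assms[unfolded monic_mv_poly_iff]] by simp

text \<open>Left coefficients suffice: subtracting the leading coefficient times \<open>P n\<close> lowers the degree,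
  because \<open>P n\<close> is monic.\<close>
lemma mat_poly_below_expand:
  assumes monic: "\<And>n. monic_mv_poly n (P n)" and "mat_poly_below n F"
  shows "\<exists>c. \<forall>x. F x = (\<Sum>i<n. c i ** P i x)"
  using assms(2)
proof (induction n arbitrary: F)
  case 0
  then show ?case by (auto simp: mat_poly_below_def)
next
  case (Suc n)
  then obtain a where a: "\<And>x. F x = (\<Sum>i<Suc n. x ^ i *\<^sub>R a i)"
    unfolding mat_poly_below_def by blast
  have "mat_poly_below n (\<lambda>x. \<Sum>i<n. x ^ i *\<^sub>R a i)"
    unfolding mat_poly_below_def by blast
  moreover have "mat_poly_below n (\<lambda>x. a n ** (P n x - x ^ n *\<^sub>R mat 1))"
    using monic by (intro mat_poly_below_lmult) (simp add: monic_mv_poly_iff)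
  ultimately have "mat_poly_below n (\<lambda>x. (\<Sum>i<n. x ^ i *\<^sub>R a i) - a n ** (P n x - x ^ n *\<^sub>R mat 1))"
    by (rule mat_poly_below_diff)
  then have "mat_poly_below n (\<lambda>x. F x - a n ** P n x)"
    by (simp add: a cmat_mult.diff_right cmat_mult.scaleR_right algebra_simps)
  then obtain c where c: "\<And>x. F x - a n ** P n x = (\<Sum>i<n. c i ** P i x)"
    using Suc.IH by blast
  have "F x = (\<Sum>i<Suc n. (c(n := a n)) i ** P i x)" for x
    using c[of x] by (simp add: algebra_simps)
  then show ?case by blast
qed

section \<open>The matrix valued inner product\<close>

lemma set_integrable_bounded_linear:
  assumes "bounded_linear h" "set_integrable M S f"
  shows "set_integrable M S (\<lambda>x. h (f x))"
  using integrable_bounded_linear[OF assms[unfolded set_integrable_def]]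
  unfolding set_integrable_def
  by (simp add: linear_scale[OF bounded_linear.linear[OF assms(1)]])

lemma set_integral_bounded_linear:
  assumes "bounded_linear h" "set_integrable M S f"
  shows "(LINT x:S|M. h (f x)) = h (LINT x:S|M. f x)"
  using integral_bounded_linear[OF assms[unfolded set_integrable_def]]
  unfolding set_lebesgue_integral_def
  by (simp add: linear_scale[OF bounded_linear.linear[OF assms(1)]])

lemma set_integrable_finite_sum:
  assumes "\<And>i. i \<in> A \<Longrightarrow> set_integrable M S (f i)"
  shows "set_integrable M S (\<lambda>x. \<Sum>i\<in>A. f i x)"
  using assms unfolding set_integrable_def by (simp add: scaleR_sum_right)

lemma set_integral_finite_sum:
  assumes "\<And>i. i \<in> A \<Longrightarrow> set_integrable M S (f i)"
  shows "(LINT x:S|M. \<Sum>i\<in>A. f i x) = (\<Sum>i\<in>A. LINT x:S|M. f i x)"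
  using assms unfolding set_integrable_def set_lebesgue_integral_def by (simp add: scaleR_sum_right)

lemma mv_integrable:
  assumes W: "matrix_weight I W" and "mat_poly_below a F" "mat_poly_below b G"
  shows "set_integrable lborel I (\<lambda>x. F x ** W x ** ctranspose (G x))"
proof -
  obtain f g where f: "\<And>x. F x = (\<Sum>i<a. x ^ i *\<^sub>R f i)" and g: "\<And>x. G x = (\<Sum>i<b. x ^ i *\<^sub>R g i)"
    using assms unfolding mat_poly_below_def by metis
  have "bounded_linear (\<lambda>X. f i ** X ** ctranspose (g l))" for i l
    by (intro bounded_linear_compose[OF cmat_mult.bounded_linear_left cmat_mult.bounded_linear_right])
  moreover have "set_integrable lborel I (\<lambda>x. x ^ (i + l) *\<^sub>R W x)" for i l
    using W unfolding matrix_weight_def by blast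
  ultimately have "set_integrable lborel I (\<lambda>x. f i ** (x ^ (i + l) *\<^sub>R W x) ** ctranspose (g l))" for i l
    by (rule set_integrable_bounded_linear)
  then have "set_integrable lborel I
      (\<lambda>x. \<Sum>i<a. \<Sum>l<b. f i ** (x ^ (i + l) *\<^sub>R W x) ** ctranspose (g l))"
    by (intro set_integrable_finite_sum)
  also have "(\<lambda>x. \<Sum>i<a. \<Sum>l<b. f i ** (x ^ (i + l) *\<^sub>R W x) ** ctranspose (g l))
     = (\<lambda>x. F x ** W x ** ctranspose (G x))"
    unfolding f g ctranspose_linear_simps cmat_mult.sum_left cmat_mult.sum_right
    by (subst sum.swap) (simp add: cmat_mult.scaleR_left cmat_mult.scaleR_right power_add mult.commute)
  finally show ?thesis .
qed

lemma mv_inner_sum_left: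
  fixes c :: "'i \<Rightarrow> 'n::finite cmat"
  assumes W: "matrix_weight I W" and F: "\<And>i. i \<in> A \<Longrightarrow> mat_poly_below (d i) (F i)"
    and G: "mat_poly_below b G"
  shows "mv_inner I W (\<lambda>x. \<Sum>i\<in>A. c i ** F i x) G = (\<Sum>i\<in>A. c i ** mv_inner I W (F i) G)"
proof -
  have bl: "bounded_linear (\<lambda>X :: 'n cmat. c i ** X)" for i by (rule cmat_mult.bounded_linear_right)
  have int: "set_integrable lborel I (\<lambda>x. F i x ** W x ** ctranspose (G x))" if "i \<in> A" for i
    using mv_integrable[OF W F G] that .
  have "mv_inner I W (\<lambda>x. \<Sum>i\<in>A. c i ** F i x) G
      = (LINT x:I|lborel. \<Sum>i\<in>A. c i ** (F i x ** W x ** ctranspose (G x)))"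
    unfolding mv_inner_def by (simp add: cmat_mult.sum_left matrix_mul_assoc)
  also have "\<dots> = (\<Sum>i\<in>A. LINT x:I|lborel. c i ** (F i x ** W x ** ctranspose (G x)))"
    using set_integrable_bounded_linear[OF bl int] by (rule set_integral_finite_sum)
  also have "\<dots> = (\<Sum>i\<in>A. c i ** mv_inner I W (F i) G)"
    unfolding mv_inner_def using set_integral_bounded_linear[OF bl int] by (intro sum.cong refl)
  finally show ?thesis .
qed

lemma mv_inner_sum_right:
  fixes c :: "'i \<Rightarrow> 'n::finite cmat"
  assumes W: "matrix_weight I W" and F: "mat_poly_below a F"
    and G: "\<And>i. i \<in> A \<Longrightarrow> mat_poly_below (d i) (G i)"
  shows "mv_inner I W F (\<lambda>x. \<Sum>i\<in>A. c i ** G i x)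
    = (\<Sum>i\<in>A. mv_inner I W F (G i) ** ctranspose (c i))"
proof -
  have bl: "bounded_linear (\<lambda>X :: 'n cmat. X ** ctranspose (c i))" for i by (rule cmat_mult.bounded_linear_left)
  have int: "set_integrable lborel I (\<lambda>x. F x ** W x ** ctranspose (G i x))" if "i \<in> A" for i
    using mv_integrable[OF W F G] that .
  have "mv_inner I W F (\<lambda>x. \<Sum>i\<in>A. c i ** G i x)
      = (LINT x:I|lborel. \<Sum>i\<in>A. F x ** W x ** ctranspose (G i x) ** ctranspose (c i))"
    unfolding mv_inner_def
    by (simp add: cmat_mult.sum_right ctranspose_linear_simps ctranspose_mult matrix_mul_assoc)
  also have "\<dots> = (\<Sum>i\<in>A. LINT x:I|lborel. F x ** W x ** ctranspose (G i x) ** ctranspose (c i))"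
    using set_integrable_bounded_linear[OF bl int] by (rule set_integral_finite_sum)
  also have "\<dots> = (\<Sum>i\<in>A. mv_inner I W F (G i) ** ctranspose (c i))"
    unfolding mv_inner_def using set_integral_bounded_linear[OF bl int] by (intro sum.cong refl)
  finally show ?thesis .
qed

text \<open>The entries of \<open>p(x)\<^sup>* u\<close> are scalar polynomials in \<open>x\<close> whose coefficients of \<open>x ^ n\<close> are the
  entries of \<open>u\<close>.  One of them is nonzero, and that entry has finitely many roots.\<close>
lemma monic_apply_zero_finite:
  assumes p: "monic_mv_poly n p" and u: "u \<noteq> 0"
  shows "finite {x. ctranspose (p x) *v u = 0}"
proof -
  obtain a where a: "\<And>x. p x = x ^ n *\<^sub>R mat 1 + (\<Sum>i<n. x ^ i *\<^sub>R a i)"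
    using p unfolding monic_mv_poly_def by blast
  obtain r where r: "u $ r \<noteq> 0" using u by (auto simp: vec_eq_iff)
  define c where "c i = (if i = n then u $ r else (ctranspose (a i) *v u) $ r)" for i
  have lin: "linear (\<lambda>X. (X *v u) $ r)"
    by (auto intro!: linearI simp: matrix_vector_mult_def algebra_simps sum.distrib scaleR_sum_right)
  have "(ctranspose (p x) *v u) $ r = (\<Sum>i\<le>n. c i * of_real x ^ i)" for x
  proof -
    have "(ctranspose (p x) *v u) $ r
        = x ^ n *\<^sub>R (mat 1 *v u) $ r + (\<Sum>i<n. x ^ i *\<^sub>R (ctranspose (a i) *v u) $ r)"
      unfolding a ctranspose_linear_simps
        linear_add[OF lin] linear_sum[OF lin] linear_scale[OF lin] by simp
    also have "\<dots> = (\<Sum>i<n. c i * of_real x ^ i) + c n * of_real x ^ n"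
      by (simp add: c_def scaleR_conv_of_real mult.commute)
    finally show ?thesis by (simp add: lessThan_Suc_atMost[symmetric])
  qed
  from this[symmetric]
  have "of_real ` {x. ctranspose (p x) *v u = 0} \<subseteq> {z. (\<Sum>i\<le>n. c i * z ^ i) = 0}"
    by (simp add: image_subset_iff)
  moreover have "finite {z. (\<Sum>i\<le>n. c i * z ^ i) = 0}"
    unfolding polyfun_finite_roots using r by (intro exI[of _ n]) (simp add: c_def)
  ultimately have "finite ((of_real :: real \<Rightarrow> complex) ` {x. ctranspose (p x) *v u = 0})"
    by (rule finite_subset)
  then show ?thesis by (rule finite_imageD) (simp add: inj_on_def)
qed

text \<open>If \<open>u \<noteq> 0\<close>, then \<open>u\<^sup>* \<langle>p, p\<rangle> u\<close> is the integral of the nonnegative function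
  \<open>(p\<^sup>* u)\<^sup>* W (p\<^sup>* u)\<close>, which is positive almost everywhere on an interval with nonempty interior.\<close>
lemma mv_inner_monic_ker:
  assumes W: "matrix_weight I W" and p: "monic_mv_poly n p" and ker: "mv_inner I W p p *v u = 0"
  shows "u = 0"
proof (rule ccontr)
  assume u: "u \<noteq> 0"
  \<comment> \<open>The real quadratic form at \<open>u\<close>, as a bounded linear functional of the matrix, passes under the integral.\<close>
  define q where "q X = Re (\<Sum>i\<in>UNIV. cnj (u $ i) * (X *v u) $ i)" for X
  have bl: "bounded_linear q"
    unfolding linear_conv_bounded_linear[symmetric] q_def
    by (rule linearI) (simp_all add: matrix_vector_mult_def algebra_simps sum.distrib
        sum_distrib_left scaleR_sum_right)
  define f where "f x = p x ** W x ** ctranspose (p x)" for x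
  have int: "set_integrable lborel I f"
    unfolding f_def using mv_integrable[OF W] monic_imp_mat_poly_below[OF p] by blast
  have qf: "q (f x) = Re (\<Sum>i\<in>UNIV. cnj ((ctranspose (p x) *v u) $ i)
      * (W x *v (ctranspose (p x) *v u)) $ i)" for x
    unfolding q_def f_def matrix_vector_mul_assoc[symmetric]
    by (subst cnj_sum_ctranspose) (simp add: matrix_vector_mul_assoc)
  have pd: "AE x in lborel. x \<in> I \<longrightarrow> pos_def (W x)" using W unfolding matrix_weight_def by blast
  have pos: "q (f x) > 0" if "pos_def (W x)" "ctranspose (p x) *v u \<noteq> 0" for x
    using that unfolding qf pos_def_def by blast
  have nonneg: "q (f x) \<ge> 0" if "pos_def (W x)" for x
    using pos[OF that] by (cases "ctranspose (p x) *v u = 0") (auto simp: qf)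
  have "q (mv_inner I W p p) = 0" by (simp add: q_def ker)
  then have "(LINT x:I|lborel. q (f x)) = 0"
    using set_integral_bounded_linear[OF bl int] by (simp add: mv_inner_def f_def)
  moreover have "AE x in lborel. 0 \<le> indicator I x *\<^sub>R q (f x)"
    using pd by eventually_elim (auto simp: indicator_def nonneg)
  ultimately have "AE x in lborel. indicator I x *\<^sub>R q (f x) = 0"
    using set_integrable_bounded_linear[OF bl int]
    unfolding set_integrable_def set_lebesgue_integral_def
    by (simp add: integral_nonneg_eq_0_iff_AE)
  moreover have "AE x in lborel. x \<notin> {x. ctranspose (p x) *v u = 0}"
    using finite_imp_null_set_lborel[OF monic_apply_zero_finite[OF p u]] by (rule AE_not_in)
  ultimately have "AE x in lborel. x \<notin> interior I"
    using pd
  proof eventually_elim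
    case (elim x)
    then show ?case using pos[of x] interior_subset[of I] by (auto simp: indicator_def)
  qed
  then have "interior I \<in> null_sets lborel"
    by (simp add: AE_iff_null_sets)
  then have "negligible (interior I)"
    using negligible_iff_null_sets null_sets_completionI by blast
  then have "interior I = {}" using open_not_negligible by blast
  then show False using W unfolding matrix_weight_def by blast
qed

lemma invertible_mv_norm:
  assumes "matrix_weight I W" "monic_mv_poly n p"
  shows "\<exists>R. mv_inner I W p p ** R = mat 1"
  using mv_inner_monic_ker[OF assms] matrix_left_invertible_ker[of "mv_inner I W p p"]
    matrix_left_right_inverse by blast

section \<open>Block matrices with finite rows\<close>

text \<open>Only the upper bandwidth is bounded.  Every row is then finite, so the series in a
  block product is a finite sum and products are associative.\<close>
definition row_band :: "nat \<Rightarrow> 'n::finite block_matrix \<Rightarrow> bool" where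
  "row_band d X \<longleftrightarrow> (\<forall>n l. n + d < l \<longrightarrow> X n l = 0)"

lemma block_mult_finite_sum:
  assumes "row_band d X" "n + d < N"
  shows "block_mult X Y n m = (\<Sum>l<N. X n l ** Y l m)"
  unfolding block_mult_def
  by (rule suminf_finite) (use assms in \<open>auto simp: row_band_def\<close>)

lemma row_band_mult:
  assumes "row_band d X" "row_band e Y"
  shows "row_band (d + e) (block_mult X Y)"
  unfolding row_band_def
proof (intro allI impI)
  fix n l assume l: "n + (d + e) < l"
  have "X n i ** Y i l = 0" for i
    using assms l by (cases "n + d < i") (auto simp: row_band_def)
  then show "block_mult X Y n l = 0"
    by (simp add: block_mult_def)
qed

lemma block_mult_assoc:
  assumes X: "row_band d X" and Y: "row_band e Y"
  shows "block_mult (block_mult X Y) Z = block_mult X (block_mult Y Z)"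
proof (intro ext)
  fix n m
  define N where "N = Suc (n + d + e)"
  have XY: "block_mult X Y n l = (\<Sum>i<Suc (n + d). X n i ** Y i l)" for l
    by (rule block_mult_finite_sum[OF X]) simp
  have YZ: "block_mult Y Z i m = (\<Sum>l<N. Y i l ** Z l m)" if "i < Suc (n + d)" for i
    by (rule block_mult_finite_sum[OF Y]) (use that in \<open>simp add: N_def\<close>)
  have "block_mult (block_mult X Y) Z n m = (\<Sum>l<N. block_mult X Y n l ** Z l m)"
    by (rule block_mult_finite_sum[OF row_band_mult[OF X Y]]) (simp add: N_def)
  also have "\<dots> = (\<Sum>l<N. \<Sum>i<Suc (n + d). X n i ** Y i l ** Z l m)"
    by (simp only: XY cmat_mult.sum_left)
  also have "\<dots> = (\<Sum>i<Suc (n + d). \<Sum>l<N. X n i ** Y i l ** Z l m)"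
    by (rule sum.swap)
  also have "\<dots> = (\<Sum>i<Suc (n + d). X n i ** block_mult Y Z i m)"
    by (intro sum.cong refl) (simp add: YZ cmat_mult.sum_right matrix_mul_assoc)
  also have "\<dots> = block_mult X (block_mult Y Z) n m"
    by (rule block_mult_finite_sum[OF X, symmetric]) simp
  finally show "block_mult (block_mult X Y) Z n m = block_mult X (block_mult Y Z) n m" .
qed

lemma row_band_power: "row_band 1 X \<Longrightarrow> row_band j (block_power X j)"
proof (induction j)
  case 0
  then show ?case by (simp add: row_band_def)
next
  case (Suc j)
  then show ?case using row_band_mult[of 1 X j] by simp
qed

lemma block_mult_power_commute:
  assumes X: "row_band 1 X"
  shows "block_mult X (block_power X j) = block_mult (block_power X j) X"
proof (induction j)
  case 0
  have "block_mult X (block_power X 0) n m = block_mult (block_power X 0) X n m" for n m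
  proof -
    define N where "N = Suc (Suc (n + m))"
    have N: "n + 1 < N" "n + 0 < N" "m < N" "n < N" by (simp_all add: N_def)
    have "block_mult X (block_power X 0) n m = (\<Sum>l<N. if l = m then X n m else 0)"
      unfolding block_mult_finite_sum[OF X N(1)] by (intro sum.cong) auto
    also have "\<dots> = (\<Sum>l<N. if l = n then X n m else 0)"
      using N by simp
    also have "\<dots> = block_mult (block_power X 0) X n m"
      unfolding block_mult_finite_sum[OF row_band_power[OF X] N(2)] by (intro sum.cong) auto
    finally show ?thesis .
  qed
  then show ?case by blast
next
  case (Suc j)
  show ?case
    using block_mult_assoc[OF X row_band_power[OF X], of j X] by (simp add: Suc)
qed

text \<open>The two parts add up to \<open>S\<close>, whose commutator with \<open>X\<close> vanishes.\<close>
lemma block_commutator_upper_lower: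
  assumes X: "row_band d X" and S: "row_band e S" and comm: "block_mult X S = block_mult S X"
  shows "block_commutator X (upper_part S) n m = - block_commutator X (lower_part S) n m"
proof -
  define N where "N = Suc (n + d + e)"
  have up: "row_band e (upper_part S)" and low: "row_band e (lower_part S)"
    using S by (auto simp: row_band_def upper_part_def lower_part_def)
  have split: "S a b = upper_part S a b + lower_part S a b" for a b
    by (simp add: upper_part_def lower_part_def)
  have "block_mult X S n m = block_mult X (upper_part S) n m + block_mult X (lower_part S) n m"
    by (simp add: block_mult_finite_sum[OF X, of n N] N_def split[of _ m] cmat_mult.add_right
        sum.distrib del: sum.lessThan_Suc)
  moreover have "block_mult S X n m = block_mult (upper_part S) X n m + block_mult (lower_part S) X n m"
    by (simp add: block_mult_finite_sum[OF S, of n N] block_mult_finite_sum[OF up, of n N]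
        block_mult_finite_sum[OF low, of n N] N_def split[of n] cmat_mult.add_left
        sum.distrib del: sum.lessThan_Suc)
  ultimately show ?thesis
    using comm by (simp add: block_commutator_def algebra_simps)
qed

lemma row_band_jacobi: "row_band 1 (jacobi_block B C)"
  by (simp add: row_band_def jacobi_block_def)

section \<open>Recurrences and orthogonal expansions\<close>

lemma recurrence_as_jacobi:
  assumes "three_term_recurrence P B C"
  shows "x *\<^sub>R P n x = (\<Sum>l<Suc (Suc n). jacobi_block B C n l ** P l x)"
proof -
  have 1: "x *\<^sub>R P n x = P (n + 1) x + B n ** P n x + (if n = 0 then 0 else C n ** P (n - 1) x)"
    using assms unfolding three_term_recurrence_def by blast
  show ?thesis
  proof (cases n)
    case 0
    then show ?thesis using 1 by (simp add: jacobi_block_def add.commute)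
  next
    case (Suc r)
    have "(\<Sum>l<r. jacobi_block B C n l ** P l x) = 0"
      using Suc by (intro sum.neutral) (auto simp: jacobi_block_def)
    then show ?thesis using 1 Suc by (simp add: jacobi_block_def algebra_simps)
  qed
qed

text \<open>Read as an identity between semi-infinite column vectors: \<open>X P = x P\<close> implies \<open>X ^ j P = x ^ j P\<close>.
  The entries of \<open>X ^ j\<close> are therefore the coefficients of \<open>x ^ j P(x, n)\<close> in the basis \<open>P\<close>.\<close>
lemma power_recurrence:
  fixes P :: "nat \<Rightarrow> real \<Rightarrow> 'n::finite cmat"
  assumes X: "row_band 1 X" and rec: "\<And>n x. x *\<^sub>R P n x = (\<Sum>l<Suc (Suc n). X n l ** P l x)"
  shows "x ^ j *\<^sub>R P n x = (\<Sum>l<Suc (n + j). block_power X j n l ** P l x)"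
proof (induction j arbitrary: n)
  case 0
  have "(\<Sum>l<n. (if n = l then mat 1 else 0) ** P l x) = 0"
    by (intro sum.neutral) auto
  then show ?case by simp
next
  case (Suc j)
  have pow: "x ^ j *\<^sub>R P i x = (\<Sum>l<Suc (n + Suc j). block_power X j i l ** P l x)"
    if "i < Suc (Suc n)" for i
    unfolding Suc.IH using row_band_power[OF X, of j] that
    by (intro sum.mono_neutral_left) (auto simp: row_band_def)
  have "x ^ Suc j *\<^sub>R P n x = x ^ j *\<^sub>R (x *\<^sub>R P n x)"
    by (simp add: mult.commute)
  also have "\<dots> = (\<Sum>i<Suc (Suc n). X n i ** (x ^ j *\<^sub>R P i x))"
    by (simp only: rec scaleR_sum_right cmat_mult.scaleR_right)
  also have "\<dots> = (\<Sum>i<Suc (Suc n). \<Sum>l<Suc (n + Suc j). X n i ** block_power X j i l ** P l x)"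
    by (intro sum.cong refl) (simp only: lessThan_iff pow cmat_mult.sum_right matrix_mul_assoc)
  also have "\<dots> = (\<Sum>l<Suc (n + Suc j). (\<Sum>i<Suc (Suc n). X n i ** block_power X j i l) ** P l x)"
    by (subst sum.swap) (simp only: cmat_mult.sum_left)
  also have "\<dots> = (\<Sum>l<Suc (n + Suc j). block_power X (Suc j) n l ** P l x)"
    by (simp only: block_power.simps block_mult_finite_sum[OF X, of n "Suc (Suc n)"])
  finally show ?case .
qed

lemma mvops_monic: "monic_mvops I W P H \<Longrightarrow> monic_mv_poly n (P n)"
  unfolding monic_mvops_def by blast

lemma mv_inner_expansion:
  fixes c :: "nat \<Rightarrow> 'n::finite cmat"
  assumes W: "matrix_weight I W" and P: "monic_mvops I W P H" and "m < N"
  shows "mv_inner I W (\<lambda>x. \<Sum>l<N. c l ** P l x) (P m) = c m ** H m"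
proof -
  have "mv_inner I W (\<lambda>x. \<Sum>l<N. c l ** P l x) (P m) = (\<Sum>l<N. c l ** mv_inner I W (P l) (P m))"
    using monic_imp_mat_poly_below[OF mvops_monic[OF P]] by (intro mv_inner_sum_left[OF W])
  also have "\<dots> = (\<Sum>l<N. if l = m then c m ** H m else 0)"
    using P unfolding monic_mvops_def by (intro sum.cong) auto
  finally show ?thesis using \<open>m < N\<close> by simp
qed

lemma mvops_norm_right_inverse:
  assumes "matrix_weight I W" "monic_mvops I W P H"
  shows "\<exists>R. H m ** R = mat 1"
  using invertible_mv_norm[OF assms(1) mvops_monic[OF assms(2)], of m] assms(2)
  unfolding monic_mvops_def by simp

text \<open>The inner product with \<open>P m\<close> isolates the \<open>m\<close>-th coefficient times the invertible \<open>H m\<close>.\<close>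
lemma mvops_coefficients_unique:
  fixes c d :: "nat \<Rightarrow> 'n::finite cmat"
  assumes W: "matrix_weight I W" and P: "monic_mvops I W P H"
    and eq: "\<And>x. (\<Sum>l<N. c l ** P l x) = (\<Sum>l<N. d l ** P l x)" and m: "m < N"
  shows "c m = d m"
proof -
  obtain R where R: "H m ** R = mat 1" using mvops_norm_right_inverse[OF W P] by blast
  have "c m ** H m = d m ** H m"
    using mv_inner_expansion[OF W P m, of c] mv_inner_expansion[OF W P m, of d] by (simp add: eq)
  then have "c m ** (H m ** R) = d m ** (H m ** R)" by (simp add: matrix_mul_assoc)
  then show ?thesis by (simp add: R)
qed

lemma mvops_orthogonal_below:
  assumes W: "matrix_weight I W" and P: "monic_mvops I W P H" and G: "mat_poly_below n G"
  shows "mv_inner I W (P n) G = 0"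
proof -
  obtain c where c: "\<And>x. G x = (\<Sum>i<n. c i ** P i x)"
    using mat_poly_below_expand[OF mvops_monic[OF P] G] by blast
  have "mv_inner I W (P n) G = mv_inner I W (P n) (\<lambda>x. \<Sum>i<n. c i ** P i x)"
    using c by presburger
  also have "\<dots> = (\<Sum>i<n. mv_inner I W (P n) (P i) ** ctranspose (c i))"
    using monic_imp_mat_poly_below[OF mvops_monic[OF P]] by (intro mv_inner_sum_right[OF W])
  also have "\<dots> = 0"
    using P unfolding monic_mvops_def by (intro sum.neutral) auto
  finally show ?thesis .
qed

section \<open>Derivative of the Gram matrix\<close>

text \<open>The Taylor remainder is controlled by \<open>exp \<bar>h y\<bar>\<close>, and hence by the two exponentials at the end
  points \<open>h = e\<close> and \<open>h = - e\<close>.  Since \<open>h\<close> stands for the change of a parameter, those exponentials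
  belong to two weights of the same family, so they are integrable against every polynomial.\<close>
lemma exp_second_order_bound:
  fixes h e y :: real
  assumes "\<bar>h\<bar> \<le> e"
  shows "\<bar>exp (- (h * y)) - 1 + h * y\<bar> \<le> h\<^sup>2 * (y\<^sup>2 * exp (- (e * y)) + y\<^sup>2 * exp (e * y))"
proof -
  obtain r where r: "\<bar>r\<bar> \<le> \<bar>- (h * y)\<bar>"
    and *: "exp (- (h * y)) = (\<Sum>m<2. (- (h * y)) ^ m / fact m) + exp r / fact 2 * (- (h * y)) ^ 2"
    using Maclaurin_exp_le[of "- (h * y)" 2] by blast
  have "\<bar>h * y\<bar> \<le> \<bar>e * y\<bar>"
    using assms by (simp add: abs_mult mult_right_mono)
  then have "r \<le> - (e * y) \<or> r \<le> e * y" using r by linarith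
  then have "exp r \<le> exp (- (e * y)) + exp (e * y)"
    by (smt (verit) exp_ge_zero exp_le_cancel_iff)
  then have "exp r / 2 \<le> exp (- (e * y)) + exp (e * y)"
    using exp_ge_zero[of r] by linarith
  then have "exp r / 2 * (h * y)\<^sup>2 \<le> (exp (- (e * y)) + exp (e * y)) * (h * y)\<^sup>2"
    by (rule mult_right_mono) simp
  moreover have "exp (- (h * y)) - 1 + h * y = exp r / 2 * (h * y)\<^sup>2"
    using * by (simp add: eval_nat_numeral)
  moreover have "0 \<le> exp r / 2 * (h * y)\<^sup>2" by simp
  ultimately have "\<bar>exp (- (h * y)) - 1 + h * y\<bar> \<le> (exp (- (e * y)) + exp (e * y)) * (h * y)\<^sup>2"
    by (simp only: abs_of_nonneg)
  then show ?thesis by (simp add: power_mult_distrib algebra_simps)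
qed

lemma has_vector_derivative_iff_quotient:
  "(f has_vector_derivative f') (at x) \<longleftrightarrow> ((\<lambda>y. (f y - f x) /\<^sub>R (y - x)) \<longlongrightarrow> f') (at x)"
proof -
  have bl: "bounded_linear (\<lambda>h. h *\<^sub>R f')" by (rule bounded_linear_scaleR_left)
  have "norm ((f y - f x) /\<^sub>R (y - x) - f') = norm (f y - f x - (y - x) *\<^sub>R f') / norm (y - x)"
    if "y \<noteq> x" for y
  proof -
    have "(f y - f x) /\<^sub>R (y - x) - f' = (f y - f x - (y - x) *\<^sub>R f') /\<^sub>R (y - x)"
      using that by (simp add: scaleR_diff_right)
    then show ?thesis by (simp add: divide_inverse mult.commute)
  qed
  then have "((\<lambda>y. norm (f y - f x - (y - x) *\<^sub>R f') / norm (y - x)) \<longlongrightarrow> 0) (at x)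
    \<longleftrightarrow> ((\<lambda>y. norm ((f y - f x) /\<^sub>R (y - x) - f')) \<longlongrightarrow> 0) (at x)"
    by (intro Lim_cong_within) auto
  also have "\<dots> \<longleftrightarrow> ((\<lambda>y. (f y - f x) /\<^sub>R (y - x)) \<longlongrightarrow> f') (at x)"
    by (simp only: tendsto_norm_zero_iff LIM_zero_iff)
  finally show ?thesis
    unfolding has_vector_derivative_def has_derivative_iff_norm using bl by simp
qed

lemma has_vector_derivative_quadratic:
  assumes "e > 0" and bound: "\<And>y. \<bar>y - x\<bar> \<le> e \<Longrightarrow> norm (f y - f x - (y - x) *\<^sub>R f') \<le> (y - x)\<^sup>2 * K"
  shows "(f has_vector_derivative f') (at x)"
proof -
  have ev: "eventually (\<lambda>y. \<bar>y - x\<bar> \<le> e \<and> y \<noteq> x) (at x)"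
    unfolding eventually_at using \<open>e > 0\<close> by (intro exI[of _ e]) (auto simp: dist_real_def)
  have "((\<lambda>y. \<bar>y - x\<bar> * K) \<longlongrightarrow> \<bar>x - x\<bar> * K) (at x)"
    by (intro tendsto_intros)
  then have lim: "((\<lambda>y. \<bar>y - x\<bar> * K) \<longlongrightarrow> 0) (at x)" by simp
  have "((\<lambda>y. (f y - f x) /\<^sub>R (y - x) - f') \<longlongrightarrow> 0) (at x)"
  proof (rule Lim_null_comparison[OF _ lim])
    show "eventually (\<lambda>y. norm ((f y - f x) /\<^sub>R (y - x) - f') \<le> \<bar>y - x\<bar> * K) (at x)"
      using ev
    proof eventually_elim
      case (elim y)
      have "(f y - f x) /\<^sub>R (y - x) - f' = (f y - f x - (y - x) *\<^sub>R f') /\<^sub>R (y - x)"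
        using elim by (simp add: scaleR_diff_right)
      then have "norm ((f y - f x) /\<^sub>R (y - x) - f') = norm (f y - f x - (y - x) *\<^sub>R f') / \<bar>y - x\<bar>"
        by (simp add: divide_inverse mult.commute)
      also have "\<dots> \<le> (y - x)\<^sup>2 * K / \<bar>y - x\<bar>"
        using bound elim by (intro divide_right_mono) auto
      also have "\<dots> = \<bar>y - x\<bar> * K"
      proof -
        have "z \<noteq> 0 \<Longrightarrow> z\<^sup>2 * K / z = z * K" for z :: real
          by (simp add: power2_eq_square)
        from this[of "\<bar>y - x\<bar>"] show ?thesis
          using elim by simp
      qed
      finally show ?case .
    qed
  qed
  then show ?thesis
    unfolding has_vector_derivative_iff_quotient by (simp add: LIM_zero_iff)
qed

text \<open>Differentiation under the integral sign with respect to the parameter \<open>s\<close>.  The second order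
  remainder is bounded by \<open>(s - c)\<^sup>2\<close> times a fixed integral against the weights at \<open>c + e\<close> and
  \<open>c - e\<close>, which is finite because these two weights have finite moments.\<close>
lemma mv_inner_exp_derivative:
  assumes "e > 0" and W: "\<And>s. \<bar>s - c\<bar> \<le> e \<Longrightarrow> matrix_weight I (V s)"
    and V: "\<And>s x. V s x = exp (- ((s - c) * x ^ j)) *\<^sub>R V c x"
    and F: "mat_poly_below a F" and G: "mat_poly_below b G"
  shows "((\<lambda>s. mv_inner I (V s) F G) has_vector_derivative
            - mv_inner I (V c) (\<lambda>x. x ^ j *\<^sub>R F x) G) (at c)"
proof -
  define M where "M x = F x ** V c x ** ctranspose (G x)" for x
  have int: "set_integrable lborel I (\<lambda>x. x ^ i *\<^sub>R (exp (- ((s - c) * x ^ j)) *\<^sub>R M x))"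
    if "\<bar>s - c\<bar> \<le> e" for s i
    using mv_integrable[OF W[OF that] mat_poly_below_power_times[OF F, of i] G]
    by (simp add: M_def V[of s] cmat_mult.scaleR_left cmat_mult.scaleR_right mult.commute)
  have int0: "set_integrable lborel I (\<lambda>x. x ^ i *\<^sub>R M x)" for i
    using int[of c] \<open>e > 0\<close> by simp
  define g where "g x = norm (x ^ (2 * j) *\<^sub>R (exp (- (e * x ^ j)) *\<^sub>R M x))
      + norm (x ^ (2 * j) *\<^sub>R (exp (e * x ^ j) *\<^sub>R M x))" for x
  have g_int: "set_integrable lborel I g"
  proof -
    have 1: "set_integrable lborel I (\<lambda>x. x ^ (2 * j) *\<^sub>R (exp (- (e * x ^ j)) *\<^sub>R M x))"
      using int[of "c + e" "2 * j"] \<open>e > 0\<close> by simp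
    have 2: "set_integrable lborel I (\<lambda>x. x ^ (2 * j) *\<^sub>R (exp (e * x ^ j) *\<^sub>R M x))"
      using int[of "c - e" "2 * j"] \<open>e > 0\<close> by simp
    show ?thesis
      unfolding g_def by (intro set_integral_add(1) set_integrable_norm 1 2)
  qed
  show ?thesis
  proof (rule has_vector_derivative_quadratic[OF \<open>e > 0\<close>])
    fix s assume s: "\<bar>s - c\<bar> \<le> e"
    define E where "E x = exp (- ((s - c) * x ^ j)) - 1 + (s - c) * x ^ j" for x
    have i1: "set_integrable lborel I (\<lambda>x. exp (- ((s - c) * x ^ j)) *\<^sub>R M x)"
      using int[OF s, of 0] by simp
    have i2: "set_integrable lborel I M" using int0[of 0] by simp
    have i3: "set_integrable lborel I (\<lambda>x. (s - c) *\<^sub>R (x ^ j *\<^sub>R M x))"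
      using int0[of j] by (intro set_integrable_scaleR_right) auto
    have EM: "E x *\<^sub>R M x = exp (- ((s - c) * x ^ j)) *\<^sub>R M x - M x + (s - c) *\<^sub>R (x ^ j *\<^sub>R M x)" for x
      by (simp add: E_def algebra_simps)
    have i4: "set_integrable lborel I (\<lambda>x. E x *\<^sub>R M x)"
      unfolding EM by (intro set_integral_add(1) set_integral_diff(1) i1 i2 i3)
    have "mv_inner I (V s) F G - mv_inner I (V c) F G
        - (s - c) *\<^sub>R (- mv_inner I (V c) (\<lambda>x. x ^ j *\<^sub>R F x) G)
      = (LINT x:I|lborel. exp (- ((s - c) * x ^ j)) *\<^sub>R M x) - (LINT x:I|lborel. M x)
        + (LINT x:I|lborel. (s - c) *\<^sub>R (x ^ j *\<^sub>R M x))"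
      by (simp add: mv_inner_def M_def V[of s] cmat_mult.scaleR_left cmat_mult.scaleR_right
          del: scaleR_scaleR)
    also have "\<dots> = (LINT x:I|lborel. E x *\<^sub>R M x)"
      unfolding EM
      by (simp only: set_integral_add(2)[OF set_integral_diff(1)[OF i1 i2] i3]
          set_integral_diff(2)[OF i1 i2])
    also have "norm \<dots> \<le> (LINT x:I|lborel. (s - c)\<^sup>2 * g x)"
      unfolding set_lebesgue_integral_def
    proof (rule Bochner_Integration.integral_norm_bound_integral)
      show "integrable lborel (\<lambda>x. indicator I x *\<^sub>R (E x *\<^sub>R M x))"
        using i4 by (simp add: set_integrable_def)
      show "integrable lborel (\<lambda>x. indicator I x *\<^sub>R ((s - c)\<^sup>2 * g x))"
        using set_integrable_mult_right[of "(s - c)\<^sup>2", OF g_int] by (simp add: set_integrable_def)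
      fix x
      have "norm (E x *\<^sub>R M x) \<le> (s - c)\<^sup>2 *
          ((x ^ j)\<^sup>2 * exp (- (e * x ^ j)) + (x ^ j)\<^sup>2 * exp (e * x ^ j)) * norm (M x)"
        unfolding E_def norm_scaleR real_norm_def
        by (intro mult_right_mono exp_second_order_bound s norm_ge_zero)
      also have "\<dots> = (s - c)\<^sup>2 * g x"
        by (simp add: g_def power_mult mult.commute[of 2] algebra_simps)
      finally show "norm (indicator I x *\<^sub>R (E x *\<^sub>R M x)) \<le> indicator I x *\<^sub>R ((s - c)\<^sup>2 * g x)"
        by (simp add: indicator_def)
    qed
    finally show "norm (mv_inner I (V s) F G - mv_inner I (V c) F G
        - (s - c) *\<^sub>R (- mv_inner I (V c) (\<lambda>x. x ^ j *\<^sub>R F x) G)) \<le> (s - c)\<^sup>2 * (LINT x:I|lborel. g x)"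
      by simp
  qed
qed

section \<open>Derivative of the coefficients of the orthogonal polynomials\<close>

text \<open>As \<open>g\<close> vanishes at \<open>x\<close>, the difference quotient of the product is \<open>f\<close> times the difference
  quotient of \<open>g\<close>, which tends to \<open>0\<close> times \<open>g'\<close>.  The product rule cannot be used here: it will be
  applied to a factor \<open>f\<close> that is so far only known to tend to zero.\<close>
lemma has_vector_derivative_mult_null:
  fixes f g :: "real \<Rightarrow> 'n::finite cmat"
  assumes f: "(f \<longlongrightarrow> 0) (at x)" and g: "(g has_vector_derivative g') (at x)" and "g x = 0"
  shows "((\<lambda>y. f y ** g y) has_vector_derivative 0) (at x)"
proof -
  have "((\<lambda>y. (g y - g x) /\<^sub>R (y - x)) \<longlongrightarrow> g') (at x)"
    using g by (simp only: has_vector_derivative_iff_quotient)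
  with f have "((\<lambda>y. f y ** ((g y - g x) /\<^sub>R (y - x))) \<longlongrightarrow> 0 ** g') (at x)"
    by (rule cmat_mult.tendsto)
  then show ?thesis
    unfolding has_vector_derivative_iff_quotient by (simp add: \<open>g x = 0\<close> cmat_mult.scaleR_right)
qed

text \<open>Row \<open>n\<close> of the triangular matrix \<open>A(s)\<close> solves a linear system whose data \<open>D(s)\<close> vanish at \<open>c\<close>.
  A priori nothing is known about the regularity of \<open>A\<close>.  The system itself bounds the size of \<open>A\<close>
  by a multiple of \<open>\<parallel>D\<parallel>\<close> once \<open>D\<close> is small.  Thus \<open>A \<rightarrow> 0\<close>, the products \<open>A D\<close> are of smaller
  order than \<open>D\<close>, and to first order \<open>A = - D R\<close> with the inverses \<open>R\<close> of the diagonal blocks \<open>H\<close>.\<close>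
lemma perturbed_system_derivative:
  fixes A :: "real \<Rightarrow> nat \<Rightarrow> 'n::finite cmat" and D :: "real \<Rightarrow> 'n block_matrix"
    and H R :: "nat \<Rightarrow> 'n cmat"
  assumes eq: "eventually (\<lambda>s. \<forall>m<n. A s m ** H m + D s n m + (\<Sum>l<n. A s l ** D s l m) = 0) (nhds c)"
    and R: "\<And>m. H m ** R m = mat 1"
    and D: "\<And>l m. ((\<lambda>s. D s l m) has_vector_derivative D' l m) (at c)"
    and D0: "\<And>l m. D c l m = 0"
    and "m < n"
  shows "((\<lambda>s. A s m) has_vector_derivative - (D' n m ** R m)) (at c)" and "A c m = 0"
proof -
  have solve: "A s m = - (D s n m ** R m) - (\<Sum>l<n. A s l ** D s l m) ** R m"
    if "\<forall>m<n. A s m ** H m + D s n m + (\<Sum>l<n. A s l ** D s l m) = 0" "m < n" for s m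
  proof -
    have "A s m ** H m = - D s n m - (\<Sum>l<n. A s l ** D s l m)"
      using that by (simp add: eq_diff_eq eq_neg_iff_add_eq_0 ac_simps)
    then have "A s m ** H m ** R m = (- D s n m - (\<Sum>l<n. A s l ** D s l m)) ** R m" by simp
    then show ?thesis
      by (simp add: matrix_mul_assoc[symmetric] R cmat_mult.diff_left cmat_mult.minus_left)
  qed
  have eq_c: "\<forall>m<n. A c m ** H m + D c n m + (\<Sum>l<n. A c l ** D c l m) = 0"
    using eq by (rule eventually_nhds_x_imp_x)
  show A0: "A c m = 0" using solve[OF eq_c \<open>m < n\<close>] by (simp add: D0)
  have "\<exists>K>0. \<forall>(X :: 'n cmat) (Y :: 'n cmat). norm (X ** Y) \<le> norm X * norm Y * K"
    by (rule cmat_mult.pos_bounded)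
  then obtain K where "K > 0" and K': "\<forall>(X :: 'n cmat) (Y :: 'n cmat). norm (X ** Y) \<le> norm X * norm Y * K"
    by (elim exE conjE) (rule that)
  have K: "norm (X ** Y) \<le> norm X * norm Y * K" for X Y :: "'n cmat"
    using K' by (elim allE)
  define r where "r = (\<Sum>m<n. norm (R m))"
  define \<delta> where "\<delta> s = (\<Sum>l\<le>n. \<Sum>m<n. norm (D s l m))" for s
  define \<alpha> where "\<alpha> s = (\<Sum>m<n. norm (A s m))" for s
  have "r \<ge> 0" "\<delta> s \<ge> 0" "\<alpha> s \<ge> 0" for s
    by (simp_all add: r_def \<delta>_def \<alpha>_def sum_nonneg)
  have D_le: "norm (D s l m) \<le> \<delta> s" if "l \<le> n" "m < n" for s l m
  proof -
    have "norm (D s l m) \<le> (\<Sum>m<n. norm (D s l m))"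
      using that by (intro member_le_sum) auto
    also have "\<dots> \<le> \<delta> s"
      unfolding \<delta>_def using that
      by (intro member_le_sum[where f = "\<lambda>l. \<Sum>m<n. norm (D s l m)"]) (auto intro: sum_nonneg)
    finally show ?thesis .
  qed
  have lim_\<delta>: "(\<delta> \<longlongrightarrow> 0) (at c)"
  proof -
    have "((\<lambda>s. D s l m) \<longlongrightarrow> 0) (at c)" for l m
      using has_vector_derivative_continuous[OF D, of l m] by (simp add: continuous_within D0)
    then show ?thesis
      unfolding \<delta>_def by (intro tendsto_null_sum tendsto_norm_zero)
  qed
  have estimate: "\<alpha> s \<le> \<delta> s * (K * r) + \<alpha> s * (\<delta> s * (K * K * r))"
    if s: "\<forall>m<n. A s m ** H m + D s n m + (\<Sum>l<n. A s l ** D s l m) = 0" for s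
  proof -
    have "norm (A s m) \<le> (\<delta> s + \<alpha> s * \<delta> s * K) * norm (R m) * K" if "m < n" for m
    proof -
      have "norm (\<Sum>l<n. A s l ** D s l m) \<le> (\<Sum>l<n. norm (A s l) * \<delta> s * K)"
        using \<open>K > 0\<close> \<open>m < n\<close>
        by (intro sum_norm_le order_trans[OF K] mult_right_mono mult_left_mono D_le) auto
      also have "\<dots> = \<alpha> s * \<delta> s * K" by (simp add: \<alpha>_def sum_distrib_right)
      finally have 1: "norm (\<Sum>l<n. A s l ** D s l m) \<le> \<alpha> s * \<delta> s * K" .
      have "A s m = (- D s n m - (\<Sum>l<n. A s l ** D s l m)) ** R m"
        using solve[OF s \<open>m < n\<close>] by (simp add: cmat_mult.diff_left cmat_mult.minus_left)
      then have "norm (A s m) \<le> norm (- D s n m - (\<Sum>l<n. A s l ** D s l m)) * norm (R m) * K"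
        using K by metis
      also have "\<dots> \<le> (\<delta> s + \<alpha> s * \<delta> s * K) * norm (R m) * K"
        using D_le[of n m s] 1 norm_triangle_ineq4[of "- D s n m" "\<Sum>l<n. A s l ** D s l m"] that \<open>K > 0\<close>
        by (intro mult_right_mono) auto
      finally show ?thesis .
    qed
    then have "(\<Sum>m<n. norm (A s m)) \<le> (\<Sum>m<n. (\<delta> s + \<alpha> s * \<delta> s * K) * norm (R m) * K)"
      by (intro sum_mono) auto
    then have "\<alpha> s \<le> (\<Sum>m<n. (\<delta> s + \<alpha> s * \<delta> s * K) * norm (R m) * K)"
      by (simp only: \<alpha>_def)
    also have "\<dots> = \<delta> s * (K * r) + \<alpha> s * (\<delta> s * (K * K * r))"
      by (simp add: r_def sum_distrib_left sum.distrib algebra_simps)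
    finally show ?thesis .
  qed
  \<comment> \<open>Where the factor of \<open>\<alpha> s\<close> on the right is below one half, that term is absorbed on the left.\<close>
  have "((\<lambda>s. \<delta> s * (K * K * r)) \<longlongrightarrow> 0) (at c)"
    using lim_\<delta> by (rule tendsto_mult_left_zero)
  then have "eventually (\<lambda>s. \<delta> s * (K * K * r) < 1 / 2) (at c)"
    by (rule order_tendstoD) simp
  moreover have ev: "eventually (\<lambda>s. \<forall>m<n. A s m ** H m + D s n m + (\<Sum>l<n. A s l ** D s l m) = 0) (at c)"
    using eq by (simp add: eventually_nhds_conv_at)
  ultimately have ev_\<alpha>: "eventually (\<lambda>s. \<alpha> s \<le> 2 * (K * r) * \<delta> s) (at c)"
  proof eventually_elim
    case (elim s)
    have "\<alpha> s * (\<delta> s * (K * K * r)) \<le> \<alpha> s * (1 / 2)"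
      using elim \<open>\<alpha> s \<ge> 0\<close> by (intro mult_left_mono) auto
    then show ?case using estimate[OF elim(2)] by (simp add: algebra_simps)
  qed
  have lim_A: "((\<lambda>s. A s l) \<longlongrightarrow> 0) (at c)" if "l < n" for l
  proof (rule Lim_null_comparison)
    show "eventually (\<lambda>s. norm (A s l) \<le> 2 * (K * r) * \<delta> s) (at c)"
      using ev_\<alpha>
    proof eventually_elim
      case (elim s)
      have "norm (A s l) \<le> \<alpha> s" unfolding \<alpha>_def using that by (intro member_le_sum) auto
      then show ?case using elim by linarith
    qed
    show "((\<lambda>s. 2 * (K * r) * \<delta> s) \<longlongrightarrow> 0) (at c)"
      using lim_\<delta> by (rule tendsto_mult_right_zero)
  qed
  have "((\<lambda>s. \<Sum>l<n. A s l ** D s l m) has_vector_derivative (\<Sum>l<n. 0)) (at c)"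
    by (intro has_vector_derivative_sum has_vector_derivative_mult_null[OF lim_A D D0]) auto
  then have sum: "((\<lambda>s. (\<Sum>l<n. A s l ** D s l m) ** R m) has_vector_derivative 0) (at c)"
    using bounded_linear.has_vector_derivative[OF cmat_mult.bounded_linear_left[of "R m"], of _ 0]
    by simp
  have "((\<lambda>s. D s n m ** R m) has_vector_derivative D' n m ** R m) (at c)"
    by (rule bounded_linear.has_vector_derivative[OF cmat_mult.bounded_linear_left D])
  then have "((\<lambda>s. - (D s n m ** R m) - (\<Sum>l<n. A s l ** D s l m) ** R m)
      has_vector_derivative - (D' n m ** R m) - 0) (at c)"
    by (intro has_vector_derivative_diff has_vector_derivative_minus sum)
  moreover have "eventually (\<lambda>s. A s m = - (D s n m ** R m) - (\<Sum>l<n. A s l ** D s l m) ** R m) (nhds c)"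
    using eq by eventually_elim (rule solve[OF _ \<open>m < n\<close>])
  ultimately show "((\<lambda>s. A s m) has_vector_derivative - (D' n m ** R m)) (at c)"
    by (subst has_vector_derivative_cong_ev[where g = "\<lambda>s. - (D s n m ** R m) - (\<Sum>l<n. A s l ** D s l m) ** R m"])
      (auto simp: A0 D0 eventually_nhds_conv_at dest: eventually_nhds_x_imp_x)
qed

section \<open>The deformed weight\<close>

text \<open>Membership of \<open>j\<close> in \<open>J\<close> matters: points of the product topology are extensional functions, and
  changing one at \<open>j\<close> must keep it extensional.\<close>
lemma open_coordinate_slice:
  assumes T: "openin (product_topology (\<lambda>_. euclideanreal) J) T" and "t \<in> T" "j \<in> J"
  shows "open {s. t(j := s) \<in> T}"
proof -
  have "t \<in> extensional J"
    using openin_subset[OF T] \<open>t \<in> T\<close> by (auto simp: PiE_def)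
  then have "continuous_map euclideanreal (product_topology (\<lambda>_. euclideanreal) J) (\<lambda>s. t(j := s))"
    using \<open>j \<in> J\<close> by (auto simp: continuous_map_componentwise extensional_def)
  from openin_continuous_map_preimage[OF this T] show ?thesis by simp
qed

lemma toda_weight_update:
  assumes "j \<in> {1..k}"
  shows "toda_weight k Wt (t(j := s)) x = exp (- ((s - t j) * x ^ j)) *\<^sub>R toda_weight k Wt t x"
proof -
  have "potential k (t(j := s)) x = s * x ^ j + (\<Sum>i\<in>{1..k} - {j}. t i * x ^ i)"
    unfolding potential_def using assms by (subst sum.remove[of _ j]) (auto intro!: sum.cong)
  moreover have "potential k t x = t j * x ^ j + (\<Sum>i\<in>{1..k} - {j}. t i * x ^ i)"
    unfolding potential_def using assms by (subst sum.remove[of _ j]) auto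
  ultimately have "- potential k (t(j := s)) x = - ((s - t j) * x ^ j) + - potential k t x"
    by (simp add: algebra_simps)
  then show ?thesis
    by (simp only: toda_weight_def exp_add scaleR_scaleR)
qed

section \<open>Change of basis between two weights\<close>

text \<open>\<open>Q n\<close> is orthogonal to \<open>P m\<close> for the weight \<open>W'\<close>, because \<open>P m\<close> has smaller degree.  Expanding
  \<open>Q n\<close> in the basis \<open>P\<close> and splitting the Gram matrix of \<open>P\<close> for \<open>W'\<close> into its diagonal value for
  \<open>W\<close> and the difference \<open>D\<close> gives the system for the coefficients.\<close>
lemma orthogonality_perturbed:
  fixes A :: "nat \<Rightarrow> 'n::finite cmat"
  assumes W: "matrix_weight I W" and P: "monic_mvops I W P H"
    and W': "matrix_weight I W'" and Q: "monic_mvops I W' Q H'"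
    and A: "\<And>x. Q n x = P n x + (\<Sum>l<n. A l ** P l x)" and "m < n"
  defines "D \<equiv> \<lambda>l m. mv_inner I W' (P l) (P m) - mv_inner I W (P l) (P m)"
  shows "A m ** H m + D n m + (\<Sum>l<n. A l ** D l m) = 0"
proof -
  have below: "mat_poly_below (Suc i) (P i)" for i
    using monic_imp_mat_poly_below[OF mvops_monic[OF P]] .
  have gram: "mv_inner I W' (P l) (P m) = D l m + (if l = m then H m else 0)" for l
    using P unfolding monic_mvops_def D_def by auto
  have "0 = mv_inner I W' (Q n) (P m)"
    using mvops_orthogonal_below[OF W' Q mat_poly_below_mono[OF below[of m]], of n] \<open>m < n\<close> by simp
  also have "Q n = (\<lambda>x. \<Sum>l<Suc n. (if l = n then mat 1 else A l) ** P l x)"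
    by (rule ext) (simp add: A add.commute)
  also have "mv_inner I W' \<dots> (P m)
      = (\<Sum>l<Suc n. (if l = n then mat 1 else A l) ** mv_inner I W' (P l) (P m))"
    by (rule mv_inner_sum_left[OF W' below below])
  also have "\<dots> = mv_inner I W' (P n) (P m) + (\<Sum>l<n. A l ** mv_inner I W' (P l) (P m))"
    by (simp add: add.commute)
  also have "(\<Sum>l<n. A l ** mv_inner I W' (P l) (P m))
      = (\<Sum>l<n. A l ** D l m) + (\<Sum>l<n. if l = m then A m ** H m else 0)"
    unfolding sum.distrib[symmetric]
    by (intro sum.cong refl) (simp add: gram cmat_mult.add_right)
  finally show ?thesis
    using \<open>m < n\<close> gram[of n] by (simp add: ac_simps)
qed

text \<open>With \<open>U = 1 + A\<close> the hypothesis on \<open>Q\<close> says \<open>Q = U P\<close>.  Evaluating \<open>x Q\<close> both as \<open>Y Q = Y U P\<close> and as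
  \<open>U (x P) = U X P\<close> and comparing coefficients gives \<open>Y U = U X\<close>.  The range of the left sum stops at
  the bandwidth of \<open>Y\<close>, the one of the right sum at the diagonal of \<open>A\<close>.\<close>
lemma recurrence_conjugation:
  fixes P Q :: "nat \<Rightarrow> real \<Rightarrow> 'n::finite cmat"
  assumes W: "matrix_weight I W" and P: "monic_mvops I W P H"
    and X: "row_band 1 X" and recX: "\<And>n x. x *\<^sub>R P n x = (\<Sum>l<Suc (Suc n). X n l ** P l x)"
    and Y: "row_band 1 Y" and recY: "\<And>n x. x *\<^sub>R Q n x = (\<Sum>l<Suc (Suc n). Y n l ** Q l x)"
    and A_lower: "\<And>n l. n \<le> l \<Longrightarrow> A n l = 0"
    and A: "\<And>n x. Q n x = P n x + (\<Sum>l<n. A n l ** P l x)"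
  shows "Y n m + (\<Sum>l<Suc (Suc n). Y n l ** A l m) = X n m + (\<Sum>l<Suc n. A n l ** X l m)"
proof (cases "m < Suc (Suc n)")
  case False
  have "Y n m = 0" "X n m = 0" using X Y False by (auto simp: row_band_def)
  moreover have "(\<Sum>l<Suc (Suc n). Y n l ** A l m) = 0"
    using False A_lower by (intro sum.neutral) auto
  moreover have "(\<Sum>l<Suc n. A n l ** X l m) = 0"
    using False X by (intro sum.neutral) (auto simp: row_band_def)
  ultimately show ?thesis by simp
next
  case True
  define N where "N = Suc (Suc n)"
  define U where "U a b = (if a = b then mat 1 else 0) + A a b" for a b
  have QU: "Q l x = (\<Sum>i<M. U l i ** P i x)" if "l < M" for l x M
  proof -
    have "(\<Sum>i<M. U l i ** P i x) = (\<Sum>i<M. if i = l then P l x else 0) + (\<Sum>i<M. A l i ** P i x)"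
      unfolding sum.distrib[symmetric]
      by (intro sum.cong refl) (auto simp: U_def cmat_mult.add_left)
    also have "(\<Sum>i<M. A l i ** P i x) = (\<Sum>i<l. A l i ** P i x)"
      using that A_lower by (intro sum.mono_neutral_right) auto
    finally show ?thesis using that by (simp add: A)
  qed
  have recX': "x *\<^sub>R P l x = (\<Sum>i<N. X l i ** P i x)" if "l < Suc n" for l x
    unfolding recX N_def using that X by (intro sum.mono_neutral_left) (auto simp: row_band_def)
  \<comment> \<open>Both sides expand \<open>x Q(x, n)\<close> in the basis \<open>P\<close>.\<close>
  have "(\<Sum>i<N. (\<Sum>l<N. Y n l ** U l i) ** P i x) = (\<Sum>i<N. (\<Sum>l<Suc n. U n l ** X l i) ** P i x)" for x
  proof -
    have "(\<Sum>i<N. (\<Sum>l<N. Y n l ** U l i) ** P i x) = (\<Sum>l<N. \<Sum>i<N. Y n l ** U l i ** P i x)"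
      unfolding cmat_mult.sum_left by (rule sum.swap)
    also have "\<dots> = (\<Sum>l<N. Y n l ** Q l x)"
      by (intro sum.cong refl) (simp add: QU[of _ N] cmat_mult.sum_right matrix_mul_assoc)
    also have "\<dots> = x *\<^sub>R Q n x" by (simp only: recY N_def)
    also have "\<dots> = (\<Sum>l<Suc n. U n l ** (x *\<^sub>R P l x))"
      by (simp only: QU[of n "Suc n"] lessI scaleR_sum_right cmat_mult.scaleR_right)
    also have "\<dots> = (\<Sum>l<Suc n. \<Sum>i<N. U n l ** X l i ** P i x)"
      by (intro sum.cong refl) (simp only: lessThan_iff recX' cmat_mult.sum_right matrix_mul_assoc)
    also have "\<dots> = (\<Sum>i<N. (\<Sum>l<Suc n. U n l ** X l i) ** P i x)"
      unfolding cmat_mult.sum_left by (rule sum.swap)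
    finally show ?thesis .
  qed
  then have eq: "(\<Sum>l<N. Y n l ** U l m) = (\<Sum>l<Suc n. U n l ** X l m)"
    using True
    by (intro mvops_coefficients_unique[OF W P, where N = N and m = m
          and c = "\<lambda>i. \<Sum>l<N. Y n l ** U l i" and d = "\<lambda>i. \<Sum>l<Suc n. U n l ** X l i"])
      (simp_all only: N_def)
  have "(\<Sum>l<N. Y n l ** U l m) = (\<Sum>l<N. if l = m then Y n m else 0) + (\<Sum>l<N. Y n l ** A l m)"
    unfolding sum.distrib[symmetric]
    by (intro sum.cong refl) (auto simp: U_def cmat_mult.add_right)
  moreover have "(\<Sum>l<Suc n. U n l ** X l m) = (\<Sum>l<Suc n. if l = n then X n m else 0) + (\<Sum>l<Suc n. A n l ** X l m)"
    unfolding sum.distrib[symmetric]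
    by (intro sum.cong refl) (auto simp: U_def cmat_mult.add_left)
  moreover have "(\<Sum>l<N. if l = m then Y n m else 0) = Y n m"
    using True unfolding N_def by (subst sum.delta) auto
  moreover have "(\<Sum>l<Suc n. if l = n then X n m else 0) = X n m"
    by (subst sum.delta) auto
  ultimately show ?thesis
    using eq unfolding N_def by argo
qed

text \<open>Formally \<open>L(s) (1 + A(s)) = (1 + A(s)) L(c)\<close> differentiates to \<open>L\<^sub>1 = A\<^sub>1 L - L A\<^sub>1\<close>, with the
  subscript marking derivatives at \<open>c\<close>, since \<open>A(c) = 0\<close>.  That \<open>L\<close> is differentiable has to be
  derived along the way: the sum in the equation for \<open>L n m\<close> involves only entries \<open>L n l\<close> with
  \<open>l > m\<close>, as \<open>A\<close> is strictly lower triangular.  So the induction runs leftwards along row \<open>n\<close>,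
  starting beyond the superdiagonal.\<close>
lemma conjugation_derivative:
  fixes L A :: "real \<Rightarrow> 'n::finite block_matrix"
  assumes eq: "eventually (\<lambda>s. \<forall>n m. L s n m + (\<Sum>l<Suc (Suc n). L s n l ** A s l m)
        = L c n m + (\<Sum>l<Suc n. A s n l ** L c l m)) (nhds c)"
    and A_lower: "\<And>s n m. n \<le> m \<Longrightarrow> A s n m = 0" and A0: "\<And>n m. A c n m = 0"
    and A': "\<And>n m. ((\<lambda>s. A s n m) has_vector_derivative A' n m) (at c)"
    and A'_lower: "\<And>n m. n \<le> m \<Longrightarrow> A' n m = 0"
  shows "((\<lambda>s. L s n m) has_vector_derivative
            (\<Sum>l<Suc n. A' n l ** L c l m) - (\<Sum>l<Suc (Suc n). L c n l ** A' l m)) (at c)"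
proof (induction "n + 2 - m" arbitrary: m rule: less_induct)
  case less
  have term_deriv: "((\<lambda>s. L s n l ** A s l m) has_vector_derivative L c n l ** A' l m) (at c)"
    if "l < Suc (Suc n)" for l
  proof (cases "l \<le> m")
    case True
    then show ?thesis by (simp add: A_lower A'_lower)
  next
    case False
    then have "n + 2 - l < n + 2 - m" using that by linarith
    from bounded_bilinear.has_vector_derivative[OF bounded_bilinear_cmat_mult less[OF this] A']
    show ?thesis by (simp add: A0)
  qed
  have "((\<lambda>s. \<Sum>l<Suc n. A s n l ** L c l m) has_vector_derivative (\<Sum>l<Suc n. A' n l ** L c l m)) (at c)"
    by (intro has_vector_derivative_sum
        bounded_linear.has_vector_derivative[OF cmat_mult.bounded_linear_left A'])
  moreover have "((\<lambda>s. \<Sum>l<Suc (Suc n). L s n l ** A s l m)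
      has_vector_derivative (\<Sum>l<Suc (Suc n). L c n l ** A' l m)) (at c)"
    using term_deriv by (intro has_vector_derivative_sum) simp
  ultimately have "((\<lambda>s. L c n m + ((\<Sum>l<Suc n. A s n l ** L c l m) - (\<Sum>l<Suc (Suc n). L s n l ** A s l m)))
      has_vector_derivative 0 + ((\<Sum>l<Suc n. A' n l ** L c l m) - (\<Sum>l<Suc (Suc n). L c n l ** A' l m))) (at c)"
    by (intro has_vector_derivative_add has_vector_derivative_diff has_vector_derivative_const)
  then have deriv: "((\<lambda>s. L c n m + ((\<Sum>l<Suc n. A s n l ** L c l m) - (\<Sum>l<Suc (Suc n). L s n l ** A s l m)))
      has_vector_derivative (\<Sum>l<Suc n. A' n l ** L c l m) - (\<Sum>l<Suc (Suc n). L c n l ** A' l m)) (at c)"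
    by (simp only: add_0)
  have ev: "eventually (\<lambda>s. s \<in> UNIV \<longrightarrow>
      L s n m = L c n m + ((\<Sum>l<Suc n. A s n l ** L c l m) - (\<Sum>l<Suc (Suc n). L s n l ** A s l m))) (nhds c)"
    using eq
  proof eventually_elim
    case (elim s)
    then have "L s n m + (\<Sum>l<Suc (Suc n). L s n l ** A s l m) = L c n m + (\<Sum>l<Suc n. A s n l ** L c l m)"
      by (elim allE)
    then show ?case by (simp only: add_diff_eq eq_diff_eq simp_thms)
  qed
  show ?case
    by (rule has_vector_derivative_cong_ev[THEN iffD2, OF ev _ deriv])
      (simp add: A0 del: sum.lessThan_Suc)
qed

section \<open>The Toda hierarchy\<close>

theorem theorem7p4:
  fixes k :: nat
    and T :: "(nat \<Rightarrow> real) set"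
    and I :: "real set"
    and Wt :: "real \<Rightarrow> complex ^ 'n ^ 'n"
    and P :: "(nat \<Rightarrow> real) \<Rightarrow> nat \<Rightarrow> real \<Rightarrow> complex ^ 'n ^ 'n"
    and H B C :: "(nat \<Rightarrow> real) \<Rightarrow> nat \<Rightarrow> complex ^ 'n ^ 'n"
    and L :: "(nat \<Rightarrow> real) \<Rightarrow> nat \<Rightarrow> nat \<Rightarrow> complex ^ 'n ^ 'n"
  assumes "even k"
    and "openin (product_topology (\<lambda>_. euclideanreal) {1..k}) T"
    and "\<And>t. t \<in> T \<Longrightarrow> t k > 0"
    and "\<And>t. t \<in> T \<Longrightarrow> matrix_weight I (toda_weight k Wt t)"
    and "\<And>t. t \<in> T \<Longrightarrow> monic_mvops I (toda_weight k Wt t) (P t) (H t)"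
    and "\<And>t. t \<in> T \<Longrightarrow> three_term_recurrence (P t) (B t) (C t)"
    and "\<And>t. L t = jacobi_block (B t) (C t)"
    and "t \<in> T"
    and "j \<in> {1..k - 1}"
  shows "((\<lambda>s. L (t(j := s)) n m) has_vector_derivative
            block_commutator (L t) (upper_part (block_power (L t) j)) n m) (at (t j))
       \<and> block_commutator (L t) (upper_part (block_power (L t) j)) n m =
            - block_commutator (L t) (lower_part (block_power (L t) j)) n m"
proof -
  have j: "j \<in> {1..k}" using assms(9) by auto
  define c where "c = t j"
  \<comment> \<open>All objects are followed along the line through \<open>t\<close> in the direction of the \<open>j\<close>-th parameter.\<close>
  define \<tau> where "\<tau> s = t(j := s)" for s
  have \<tau>_c: "\<tau> c = t" by (simp add: \<tau>_def c_def)
  define W where "W s = toda_weight k Wt (\<tau> s)" for s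
  have W_exp: "W s x = exp (- ((s - c) * x ^ j)) *\<^sub>R W c x" for s x
    unfolding W_def \<tau>_c unfolding \<tau>_def c_def by (rule toda_weight_update[OF j])
  define U where "U = {s. \<tau> s \<in> T}"
  have "open U" unfolding U_def \<tau>_def using assms(2) assms(8) j by (rule open_coordinate_slice)
  have "c \<in> U" unfolding U_def using \<tau>_c assms(8) by simp
  obtain e where "e > 0" and e: "cball c e \<subseteq> U"
    using \<open>open U\<close> \<open>c \<in> U\<close> open_contains_cball by blast
  have ev_U: "eventually (\<lambda>s. s \<in> U) (nhds c)"
    using \<open>open U\<close> \<open>c \<in> U\<close> by (rule eventually_nhds_in_open)
  have weight: "matrix_weight I (W s)" and mvops: "monic_mvops I (W s) (P (\<tau> s)) (H (\<tau> s))"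
    if "s \<in> U" for s
    using that assms(4,5) unfolding U_def W_def by auto
  have band: "row_band 1 (L s)" for s
    unfolding assms(7) by (rule row_band_jacobi)
  have rec: "x *\<^sub>R P (\<tau> s) i x = (\<Sum>l<Suc (Suc i). L (\<tau> s) i l ** P (\<tau> s) l x)" if "s \<in> U" for s i x
    unfolding assms(7) using that assms(6) unfolding U_def by (intro recurrence_as_jacobi) auto
  note weight_c = weight[OF \<open>c \<in> U\<close>] and mvops_c = mvops[OF \<open>c \<in> U\<close>, unfolded \<tau>_c]
    and rec_c = rec[OF \<open>c \<in> U\<close>, unfolded \<tau>_c]
  have below: "mat_poly_below (Suc i) (P t i)" for i
    using monic_imp_mat_poly_below[OF mvops_monic[OF mvops_c]] .

  \<comment> \<open>The coefficients of the polynomials at \<open>\<tau> s\<close> in terms of those at \<open>t\<close>, padded by zeros so that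
    they form the strictly lower triangular matrix \<open>A s\<close>.\<close>
  have ex: "\<exists>a. (\<forall>l\<ge>i. a l = 0) \<and> (s \<in> U \<longrightarrow> (\<forall>x. P (\<tau> s) i x = P t i x + (\<Sum>l<i. a l ** P t l x)))" for s i
  proof (cases "s \<in> U")
    case True
    have "mat_poly_below i (\<lambda>x. P (\<tau> s) i x - P t i x)"
      using mvops_monic[OF mvops[OF True]] mvops_monic[OF mvops_c] by (rule monic_diff)
    then obtain a where a: "\<And>x. P (\<tau> s) i x - P t i x = (\<Sum>l<i. a l ** P t l x)"
      using mat_poly_below_expand[OF mvops_monic[OF mvops_c]] by blast
    have "P (\<tau> s) i x = P t i x + (\<Sum>l<i. (if l < i then a l else 0) ** P t l x)" for x
      using a[of x] by (simp add: algebra_simps)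
    then show ?thesis by (intro exI[of _ "\<lambda>l. if l < i then a l else 0"]) auto
  qed auto
  define A where "A s i = (SOME a. (\<forall>l\<ge>i. a l = 0)
      \<and> (s \<in> U \<longrightarrow> (\<forall>x. P (\<tau> s) i x = P t i x + (\<Sum>l<i. a l ** P t l x))))" for s i
  note A_prop = someI_ex[OF ex, folded A_def]
  have A_lower: "A s i l = 0" if "i \<le> l" for s i l
    using A_prop that by auto
  have A: "P (\<tau> s) i x = P t i x + (\<Sum>l<i. A s i l ** P t l x)" if "s \<in> U" for s i x
    using A_prop that by auto

  \<comment> \<open>The change of the Gram matrix of the fixed polynomials \<open>P t\<close>, and its derivative at \<open>c\<close>.\<close>
  define D where "D s l i = mv_inner I (W s) (P t l) (P t i) - mv_inner I (W c) (P t l) (P t i)" for s l i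
  define D' where "D' l i = - mv_inner I (W c) (\<lambda>x. x ^ j *\<^sub>R P t l x) (P t i)" for l i
  have D_deriv: "((\<lambda>s. D s l i) has_vector_derivative D' l i) (at c)" for l i
  proof -
    have "((\<lambda>s. mv_inner I (W s) (P t l) (P t i)) has_vector_derivative D' l i) (at c)"
      unfolding D'_def
    proof (rule mv_inner_exp_derivative[OF \<open>e > 0\<close> _ W_exp below below])
      fix s assume "\<bar>s - c\<bar> \<le> e"
      then have "s \<in> cball c e" by (simp add: dist_real_def abs_minus_commute)
      then show "matrix_weight I (W s)" using e weight by blast
    qed
    then have "((\<lambda>s. mv_inner I (W s) (P t l) (P t i) - mv_inner I (W c) (P t l) (P t i))
        has_vector_derivative D' l i - 0) (at c)"
      by (intro has_vector_derivative_diff has_vector_derivative_const)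
    then show ?thesis by (simp add: D_def)
  qed
  have "\<exists>R. \<forall>i. H t i ** R i = mat 1"
    using mvops_norm_right_inverse[OF weight_c mvops_c] by (intro choice allI)
  then obtain R where R: "\<And>i. H t i ** R i = mat 1" by blast
  define S where "S = lower_part (block_power (L t) j)"
  \<comment> \<open>The derivative of the Gram matrix is \<open>- L ^ j H\<close>, because \<open>x ^ j P = L ^ j P\<close>.  Dividing by the
    norms leaves the strictly lower part of \<open>L ^ j\<close>.\<close>
  have D'_R: "- (D' i l ** R l) = S i l" if "l < i" for i l
  proof -
    have "D' i l = - mv_inner I (W c) (\<lambda>x. \<Sum>l<Suc (i + j). block_power (L t) j i l ** P t l x) (P t l)"
      unfolding D'_def power_recurrence[OF band rec_c] ..
    also have "\<dots> = - (block_power (L t) j i l ** H t l)"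
      using that by (subst mv_inner_expansion[OF weight_c mvops_c]) auto
    finally have "- (D' i l ** R l) = block_power (L t) j i l ** (H t l ** R l)"
      by (simp add: cmat_mult.minus_left matrix_mul_assoc)
    then show ?thesis using that by (simp add: R S_def lower_part_def)
  qed
  \<comment> \<open>Orthogonality at \<open>\<tau> s\<close> determines \<open>A s\<close>, and with it the derivative of \<open>A\<close> at \<open>c\<close>.\<close>
  have system: "eventually (\<lambda>s. \<forall>l<i. A s i l ** H t l + D s i l + (\<Sum>r<i. A s i r ** D s r l) = 0) (nhds c)" for i
    using ev_U
  proof eventually_elim
    case (elim s)
    show ?case
      unfolding D_def
      using orthogonality_perturbed[OF weight_c mvops_c weight[OF elim] mvops[OF elim] A[OF elim]] by blast
  qed
  have D_c: "D c l i = 0" for l i by (simp add: D_def)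
  have A_c: "A c i l = 0" for i l
    using perturbed_system_derivative(2)[OF system R D_deriv D_c] A_lower by (cases "l < i") auto
  have A_deriv: "((\<lambda>s. A s i l) has_vector_derivative S i l) (at c)" for i l
  proof (cases "l < i")
    case True
    from perturbed_system_derivative(1)[OF system R D_deriv D_c True]
    show ?thesis by (simp only: D'_R[OF True])
  next
    case False
    then show ?thesis by (simp add: A_lower S_def lower_part_def)
  qed

  \<comment> \<open>The recurrences at \<open>\<tau> s\<close> and at \<open>t\<close> conjugate the two Jacobi matrices by \<open>1 + A s\<close>.\<close>
  have conj: "eventually (\<lambda>s. \<forall>n m. L (\<tau> s) n m + (\<Sum>l<Suc (Suc n). L (\<tau> s) n l ** A s l m)
        = L (\<tau> c) n m + (\<Sum>l<Suc n. A s n l ** L (\<tau> c) l m)) (nhds c)"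
    using ev_U
  proof eventually_elim
    case (elim s)
    show ?case
      unfolding \<tau>_c
      using recurrence_conjugation[OF weight_c mvops_c band rec_c band rec[OF elim] A_lower A[OF elim]]
      by blast
  qed
  have "((\<lambda>s. L (\<tau> s) n m) has_vector_derivative
      (\<Sum>l<Suc n. S n l ** L (\<tau> c) l m) - (\<Sum>l<Suc (Suc n). L (\<tau> c) n l ** S l m)) (at c)"
    by (rule conjugation_derivative[OF conj A_lower A_c A_deriv]) (simp_all add: S_def lower_part_def)
  moreover have "row_band 0 S" by (simp add: S_def row_band_def lower_part_def)
  then have "(\<Sum>l<Suc n. S n l ** L t l m) = block_mult S (L t) n m"
    by (rule block_mult_finite_sum[symmetric]) simp
  moreover have "(\<Sum>l<Suc (Suc n). L t n l ** S l m) = block_mult (L t) S n m"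
    by (rule block_mult_finite_sum[OF band, symmetric]) simp
  moreover have up_low: "block_commutator (L t) (upper_part (block_power (L t) j)) n m
      = - block_commutator (L t) S n m"
    unfolding S_def
    by (rule block_commutator_upper_lower[OF band row_band_power[OF band] block_mult_power_commute[OF band]])
  ultimately show ?thesis
    by (simp add: \<tau>_c block_commutator_def \<tau>_def c_def S_def del: sum.lessThan_Suc)
qed

end
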